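(* Let $H$ be a complex Hilbert space, let $R_0\in B(H)_+$, and let $(u_n)_{n\ge 0}\subset H$ be a sequence of unit vectors. Define $R_{n+1}=R_n^{1/2}(I-P_n)R_n^{1/2}$ with $P_n=|u_n\rangle\langle u_n|$ for $n\ge 0$. Then the sequence $(R_n)_{n\ge 0}$ is decreasing in the Löwner order and bounded below by $0$. There is a unique positive operator $R_\infty\in B(H)_+$ such that $$\langle x,R_\infty x\rangle=\lim_{n\to\infty}\langle x,R_nx\rangle,\qquad x\in H,$$ and $R_n\to R_\infty$ in the strong operator topology.
   Context: $B(H)_+$ is the set of bounded positive operators on $H$, ordered by the Löwner order: $0\le A\le B$ iff $0\le\langle x,Ax\rangle\le\langle x,Bx\rangle$ for all $x\in H$. Inner products are linear in the second variable. $|a\rangle\langle b|$ denotes the operator $x\mapsto\langle b,x\rangle a$. The map $R\mapsto R^{1/2}(I-|u\rangle\langle u|)R^{1/2}$ sends $B(H)_+$ into itself for each unit vector $u$, so the recursion is well defined (if some $R_n=0$, then $R_k=0$ for all $k\ge n$). *)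

theory Defs
  imports "HOL-Analysis.Analysis"
begin

class complex_inner = real_normed_vector +
  fixes scaleC :: "complex \<Rightarrow> 'a \<Rightarrow> 'a" (infixr "*\<^sub>C" 75)
    and cinner :: "'a \<Rightarrow> 'a \<Rightarrow> complex"
  assumes scaleC_of_real: "complex_of_real r *\<^sub>C x = r *\<^sub>R x"
    and scaleC_add_right: "a *\<^sub>C (x + y) = a *\<^sub>C x + a *\<^sub>C y"
    and scaleC_add_left: "(a + b) *\<^sub>C x = a *\<^sub>C x + b *\<^sub>C x"
    and scaleC_scaleC: "a *\<^sub>C b *\<^sub>C x = (a * b) *\<^sub>C x"
    and cinner_commute: "cinner x y = cnj (cinner y x)"
    and cinner_add_right: "cinner x (y + z) = cinner x y + cinner x z"
    and cinner_scaleC_right: "cinner x (a *\<^sub>C y) = a * cinner x y"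
    and cinner_nonneg: "0 \<le> cinner x x"
    and cinner_eq_zero_iff: "cinner x x = 0 \<longleftrightarrow> x = 0"
    and norm_eq_sqrt_cinner: "norm x = sqrt (Re (cinner x x))"

class complex_hilbert_space = complex_inner + complete_space

text \<open>The order on \<^typ>\<open>complex\<close> is the one of \<^theory>\<open>HOL-Library.Complex_Order\<close>: \<open>z \<le> w\<close> means
  \<open>Re z \<le> Re w\<close> and \<open>Im z = Im w\<close>, so \<open>0 \<le> z\<close> says that \<open>z\<close> is real and nonnegative.\<close>

text \<open>\<open>'a \<Rightarrow>\<^sub>L 'a\<close> is the type of bounded real-linear maps; \<open>B(H)\<close> is its complex-linear part.\<close>

definition bounded_ops :: "('a::complex_inner \<Rightarrow>\<^sub>L 'a) set" where
  "bounded_ops = {A. \<forall>c x. blinfun_apply A (c *\<^sub>C x) = c *\<^sub>C blinfun_apply A x}"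

definition positive_ops :: "('a::complex_inner \<Rightarrow>\<^sub>L 'a) set" where
  "positive_ops = {A \<in> bounded_ops. \<forall>x. 0 \<le> cinner x (blinfun_apply A x)}"

definition loewner_le :: "('a::complex_inner \<Rightarrow>\<^sub>L 'a) \<Rightarrow> ('a \<Rightarrow>\<^sub>L 'a) \<Rightarrow> bool" where
  "loewner_le A B \<longleftrightarrow>
     (\<forall>x. cinner x (blinfun_apply A x) \<le> cinner x (blinfun_apply B x))"

text \<open>The positive square root; meaningful for \<open>A \<in> positive_ops\<close> on a Hilbert space.\<close>

definition op_sqrt :: "('a::complex_inner \<Rightarrow>\<^sub>L 'a) \<Rightarrow> ('a \<Rightarrow>\<^sub>L 'a)" where
  "op_sqrt A = (THE S. S \<in> positive_ops \<and> S o\<^sub>L S = A)"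

lemma cinner_add_left:
  fixes x y z :: "'a::complex_inner"
  shows "cinner (x + y) z = cinner x z + cinner y z"
  by (metis cinner_add_right cinner_commute complex_cnj_add)

lemma cinner_scaleC_left:
  fixes x y :: "'a::complex_inner"
  shows "cinner (a *\<^sub>C x) y = cnj a * cinner x y"
  by (metis cinner_scaleC_right cinner_commute complex_cnj_mult)

lemma cinner_self:
  fixes x :: "'a::complex_inner"
  shows "cinner x x = complex_of_real ((norm x)\<^sup>2)"
  using cinner_nonneg[of x] by (simp add: norm_eq_sqrt_cinner less_eq_complex_def complex_eq_iff)

lemma norm_scaleC:
  fixes x :: "'a::complex_inner"
  shows "norm (a *\<^sub>C x) = cmod a * norm x"
proof -
  have "cinner (a *\<^sub>C x) (a *\<^sub>C x) = complex_of_real ((cmod a * norm x)\<^sup>2)"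
    by (simp add: cinner_scaleC_left cinner_scaleC_right cinner_self[of x] power_mult_distrib
        complex_norm_square mult_ac del: of_real_power)
  then have "(norm (a *\<^sub>C x))\<^sup>2 = (cmod a * norm x)\<^sup>2"
    unfolding cinner_self of_real_eq_iff .
  then show ?thesis by simp
qed

lemma cinner_Cauchy_Schwarz:
  fixes x y :: "'a::complex_inner"
  shows "cmod (cinner x y) \<le> norm x * norm y"
proof (cases "x = 0")
  case True
  have "cinner x y = 0"
    using cinner_add_left[of 0 0 y] True by simp
  then show ?thesis by simp
next
  case False
  define n where "n = (norm x)\<^sup>2"
  define c where "c = cinner x y"
  define z where "z = of_real n *\<^sub>C y + (- c) *\<^sub>C x"
  have n: "n > 0" using False by (simp add: n_def)
  have "cinner z z = of_real n * (of_real n * cinner y y - c * cnj c)"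
    by (simp add: z_def cinner_add_left cinner_add_right cinner_scaleC_left cinner_scaleC_right
        cinner_self[of x] n_def[symmetric] c_def[symmetric] cinner_commute[of y x] algebra_simps)
  also have "\<dots> = complex_of_real (n * (n * (norm y)\<^sup>2 - (cmod c)\<^sup>2))"
    by (simp add: cinner_self[of y] complex_norm_square del: of_real_power)
  finally have "0 \<le> n * (n * (norm y)\<^sup>2 - (cmod c)\<^sup>2)"
    using cinner_nonneg[of z] by (simp add: less_eq_complex_def)
  with n have "(cmod c)\<^sup>2 \<le> (norm x * norm y)\<^sup>2"
    by (simp add: zero_le_mult_iff n_def power_mult_distrib)
  then show ?thesis unfolding c_def by (rule power2_le_imp_le) simp
qed

text \<open>\<open>|a\<rangle>\<langle>b|\<close>\<close>

lift_definition rank_one :: "'a::complex_inner \<Rightarrow> 'a \<Rightarrow> 'a \<Rightarrow>\<^sub>L 'a" is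
  "\<lambda>a b x. cinner b x *\<^sub>C a"
proof (rule bounded_linear_intro)
  fix a b x y :: 'a and r :: real
  show "cinner b (x + y) *\<^sub>C a = cinner b x *\<^sub>C a + cinner b y *\<^sub>C a"
    by (simp add: cinner_add_right scaleC_add_left)
  show "cinner b (r *\<^sub>R x) *\<^sub>C a = r *\<^sub>R (cinner b x *\<^sub>C a)"
    by (simp add: cinner_scaleC_right scaleC_scaleC flip: scaleC_of_real)
  show "norm (cinner b x *\<^sub>C a) \<le> norm x * (norm b * norm a)"
    using mult_right_mono[OF cinner_Cauchy_Schwarz[of b x] norm_ge_zero[of a]]
    by (simp add: norm_scaleC mult_ac)
qed

end

theory Submission
  imports Defs
begin

text \<open>
  Write \<open>T\<close> for the positive square root of \<open>R n\<close> and \<open>u\<close> for the unit vector \<open>u n\<close>. Since \<open>T\<close> is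
  self-adjoint, the form of \<open>R n\<close> at \<open>x\<close> is the squared norm of \<open>T x\<close>, and the form of \<open>R (Suc n)\<close>
  is that number minus the squared modulus of \<open>cinner u (T x)\<close>. By Cauchy-Schwarz the result is
  still nonnegative, so each step stays inside the positive operators and goes down in the
  Loewner order (\<open>residual_step\<close>).

  Monotone convergence then gives the limit. The key estimate (\<open>norm_sq_le_form\<close>) says that a
  positive operator whose form is at most \<open>M\<close> times the squared norm maps \<open>x\<close> to a vector of
  squared norm at most \<open>M\<close> times its form at \<open>x\<close>. Applied to the positive differences
  \<open>R m - R n\<close>, it turns convergence of the decreasing real sequence of forms at \<open>x\<close> into the Cauchy
  property of \<open>R n x\<close> (\<open>decreasing_positive_ops_converge\<close>). The limit is therefore strong from the
  start. It is the only operator with these limiting forms, because over the complex numbers an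
  operator is determined by its form; so every operator that is a limit in the sense of forms is
  the strong limit.

  What remains is that the square root in the recursion exists and is unique (\<open>op_sqrt_spec\<close>).
  After scaling, \<open>A = I - B\<close> with \<open>B\<close> self-adjoint of norm at most \<open>1\<close>, and \<open>(I - Y)\<^sup>2 = I - B\<close>
  says that \<open>Y\<close> is a fixed point of \<open>Y \<mapsto> (B + Y\<^sup>2) / 2\<close>. The iteration of this map from \<open>0\<close>
  is dominated step by step by the scalar iteration for \<open>B = 1\<close>, which is increasing and bounded;
  hence it converges in norm. Its limit commutes with everything that commutes with \<open>A\<close>, in
  particular with any other positive square root of \<open>A\<close>, and two commuting positive square roots
  agree.
\<close>

section \<open>The inner product as a bounded bilinear map\<close>

instance complex_hilbert_space \<subseteq> banach ..

interpretation cinner: bounded_bilinear "cinner :: 'a::complex_inner \<Rightarrow> 'a \<Rightarrow> complex"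
proof
  fix x y z :: 'a and r :: real
  show "cinner (x + y) z = cinner x z + cinner y z" by (rule cinner_add_left)
  show "cinner x (y + z) = cinner x y + cinner x z" by (rule cinner_add_right)
  show "cinner (r *\<^sub>R x) y = r *\<^sub>R cinner x y"
    using cinner_scaleC_left[of "complex_of_real r" x y]
    by (simp add: scaleC_of_real scaleR_conv_of_real)
  show "cinner x (r *\<^sub>R y) = r *\<^sub>R cinner x y"
    using cinner_scaleC_right[of x "complex_of_real r" y]
    by (simp add: scaleC_of_real scaleR_conv_of_real)
  show "\<exists>K. \<forall>x y::'a. norm (cinner x y) \<le> norm x * norm y * K"
    by (rule exI[of _ 1]) (simp add: cinner_Cauchy_Schwarz)
qed

lemma Re_cinner_self: "Re (cinner x x) = (norm x)\<^sup>2" for x :: "'a::complex_inner"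
  by (simp add: cinner_self)

lemma cinner_eqI:
  fixes x y :: "'a::complex_inner"
  assumes "\<And>z. cinner z x = cinner z y"
  shows "x = y"
proof -
  have "cinner (x - y) (x - y) = 0"
    using assms[of "x - y"] by (simp add: cinner.diff_right)
  then show ?thesis by (simp add: cinner_eq_zero_iff)
qed

text \<open>Polarization: testing the diagonal at \<open>x + y\<close> shows that \<open>s\<close> is antisymmetric, and testing it
  at \<open>x + \<i> y\<close> shows that \<open>s\<close> is symmetric.\<close>

lemma sesquilinear_zero_if_diagonal_zero:
  fixes s :: "'a::complex_inner \<Rightarrow> 'a \<Rightarrow> complex"
  assumes add: "\<And>x y z. s (x + y) z = s x z + s y z" "\<And>x y z. s x (y + z) = s x y + s x z"
    and scale: "\<And>c x y. s (c *\<^sub>C x) y = cnj c * s x y" "\<And>c x y. s x (c *\<^sub>C y) = c * s x y"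
    and diag: "\<And>x. s x x = 0"
  shows "s x y = 0"
proof -
  have "s x y + s y x = 0"
    using diag[of "x + y"] diag[of x] diag[of y] by (simp add: add add.commute)
  moreover have "\<i> * s x y - \<i> * s y x = 0"
    using diag[of "x + \<i> *\<^sub>C y"] diag[of x] diag[of y] by (simp add: add scale)
  ultimately show ?thesis
    by (simp add: complex_eq_iff)
qed

section \<open>Hermitian and positive operators\<close>

text \<open>Complex linearity is a consequence of this identity (\<open>hermitian_in_bounded_ops\<close>), and both
  sides are continuous in \<open>A\<close>; this makes self-adjointness the convenient invariant to carry through
  sums, squares and limits.\<close>

definition hermitian :: "('a::complex_inner \<Rightarrow>\<^sub>L 'a) \<Rightarrow> bool" where
  "hermitian A \<longleftrightarrow> (\<forall>x y. cinner (A x) y = cinner x (A y))"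

lemma hermitianD: "hermitian A \<Longrightarrow> cinner (A x) y = cinner x (A y)"
  by (simp add: hermitian_def)

lemma hermitian_in_bounded_ops:
  assumes "hermitian A"
  shows "A \<in> bounded_ops"
proof -
  have "A (c *\<^sub>C x) = c *\<^sub>C A x" for c x
    by (rule cinner_eqI) (simp add: cinner_scaleC_right flip: hermitianD[OF assms])
  then show ?thesis by (simp add: bounded_ops_def)
qed

lemma hermitian_Im_form: "hermitian A \<Longrightarrow> Im (cinner x (A x)) = 0"
  by (metis hermitianD cinner_commute complex_cnj_cancel_iff cnj.simps(2) neg_equal_zero)

text \<open>The sesquilinear map \<open>cinner (A x) y - cinner x (A y)\<close> vanishes on the diagonal, since the form
  of \<open>A\<close> is real.\<close>

lemma positive_imp_hermitian:
  assumes "A \<in> positive_ops"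
  shows "hermitian A"
proof -
  have lin: "A (c *\<^sub>C x) = c *\<^sub>C A x" for c x
    using assms by (simp add: positive_ops_def bounded_ops_def)
  have real: "cinner (A x) x = cinner x (A x)" for x
    using assms cinner_commute[of "A x" x]
    by (simp add: positive_ops_def less_eq_complex_def complex_eq_iff)
  have "cinner (A x) y - cinner x (A y) = 0" for x y
    by (rule sesquilinear_zero_if_diagonal_zero[where s = "\<lambda>x y. cinner (A x) y - cinner x (A y)"])
      (simp_all add: real lin cinner_add_left cinner_add_right cinner_scaleC_left
        cinner_scaleC_right blinfun.add_right algebra_simps)
  then show ?thesis by (simp add: hermitian_def)
qed

lemma positive_ops_iff:
  "A \<in> positive_ops \<longleftrightarrow> hermitian A \<and> (\<forall>x. 0 \<le> Re (cinner x (A x)))"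
proof safe
  assume A: "A \<in> positive_ops"
  show "hermitian A" by (rule positive_imp_hermitian[OF A])
  show "0 \<le> Re (cinner x (A x))" for x
    using A by (simp add: positive_ops_def less_eq_complex_def)
next
  assume "hermitian A" "\<forall>x. 0 \<le> Re (cinner x (A x))"
  then show "A \<in> positive_ops"
    by (simp add: positive_ops_def less_eq_complex_def hermitian_in_bounded_ops hermitian_Im_form)
qed

lemma hermitian_zero: "hermitian 0"
  by (simp add: hermitian_def cinner.zero_left cinner.zero_right)

lemma hermitian_id: "hermitian id_blinfun"
  by (simp add: hermitian_def)

lemma hermitian_add: "hermitian A \<Longrightarrow> hermitian B \<Longrightarrow> hermitian (A + B)"
  by (simp add: hermitian_def blinfun.add_left cinner_add_left cinner_add_right)

lemma hermitian_diff: "hermitian A \<Longrightarrow> hermitian B \<Longrightarrow> hermitian (A - B)"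
  by (simp add: hermitian_def blinfun.diff_left cinner.diff_left cinner.diff_right)

lemma hermitian_scaleR: "hermitian A \<Longrightarrow> hermitian (r *\<^sub>R A)"
  by (simp add: hermitian_def blinfun.scaleR_left cinner.scaleR_left cinner.scaleR_right)

lemma hermitian_sandwich: "hermitian T \<Longrightarrow> hermitian A \<Longrightarrow> hermitian (T o\<^sub>L A o\<^sub>L T)"
  by (simp add: hermitian_def)

lemma hermitian_square: "hermitian A \<Longrightarrow> hermitian (A o\<^sub>L A)"
  by (simp add: hermitian_def)

lemma hermitian_rank_one: "hermitian (rank_one u u)"
  unfolding hermitian_def rank_one.rep_eq
  by (simp add: cinner_scaleC_left cinner_scaleC_right flip: cinner_commute)

lemma hermitian_pointwise_limit:
  fixes L :: "'a::complex_inner \<Rightarrow>\<^sub>L 'a"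
  assumes "\<And>n. hermitian (X n)" and lim: "\<And>x. (\<lambda>n. X n x) \<longlonglongrightarrow> L x"
  shows "hermitian L"
  unfolding hermitian_def
proof (intro allI)
  fix x y
  have "(\<lambda>n. cinner (X n x) y) \<longlonglongrightarrow> cinner (L x) y"
    by (intro cinner.tendsto lim tendsto_const)
  moreover have "(\<lambda>n. cinner (X n x) y) \<longlonglongrightarrow> cinner x (L y)"
    unfolding hermitianD[OF assms(1)] by (intro cinner.tendsto lim tendsto_const)
  ultimately show "cinner (L x) y = cinner x (L y)" by (rule LIMSEQ_unique)
qed

lemma form_le_norm:
  fixes A :: "'a::complex_inner \<Rightarrow>\<^sub>L 'a"
  shows "Re (cinner x (A x)) \<le> norm A * (norm x)\<^sup>2"
proof -
  have "Re (cinner x (A x)) \<le> norm x * norm (A x)"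
    using complex_Re_le_cmod cinner_Cauchy_Schwarz order_trans by blast
  also have "\<dots> \<le> norm x * (norm A * norm x)"
    by (intro mult_left_mono norm_blinfun) simp
  finally show ?thesis by (simp add: power2_eq_square algebra_simps)
qed

text \<open>Positivity of \<open>A\<close> is tested at \<open>z = x - A x / M\<close>, one step of steepest descent for the form. The
  form at \<open>z\<close> is that at \<open>x\<close> minus twice \<open>(norm (A x))\<^sup>2 / M\<close>, plus a second-order term that the
  bound on the form at \<open>A x\<close> limits to \<open>(norm (A x))\<^sup>2 / M\<close>.\<close>

lemma norm_sq_le_form:
  assumes A: "A \<in> positive_ops" and M: "M > 0"
    and le: "\<And>x. Re (cinner x (A x)) \<le> M * (norm x)\<^sup>2"
  shows "(norm (A x))\<^sup>2 \<le> M * Re (cinner x (A x))"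
proof -
  note hA = positive_imp_hermitian[OF A]
  define z where "z = x - (1 / M) *\<^sub>R A x"
  have cross: "cinner x (A (A x)) = cinner (A x) (A x)"
    by (simp add: hermitianD[OF hA])
  have "0 \<le> Re (cinner z (A z))" using A by (simp add: positive_ops_iff)
  also have "Re (cinner z (A z)) =
      Re (cinner x (A x)) - 2 / M * (norm (A x))\<^sup>2 + (1 / M)\<^sup>2 * Re (cinner (A x) (A (A x)))"
    by (simp add: z_def blinfun.diff_right blinfun.scaleR_right cinner.diff_left cinner.diff_right
        cinner.scaleR_left cinner.scaleR_right cross Re_cinner_self power2_eq_square
        algebra_simps add_divide_distrib diff_divide_distrib)
  also have "\<dots> \<le> Re (cinner x (A x)) - 2 / M * (norm (A x))\<^sup>2 + (1 / M)\<^sup>2 * (M * (norm (A x))\<^sup>2)"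
    by (intro add_left_mono mult_left_mono le) simp
  also have "\<dots> = Re (cinner x (A x)) - (norm (A x))\<^sup>2 / M"
    using M by (simp add: field_simps power2_eq_square)
  finally show ?thesis using M by (simp add: field_simps)
qed

lemma positive_form_zero:
  assumes "A \<in> positive_ops" "Re (cinner x (A x)) = 0"
  shows "A x = 0"
proof -
  have "Re (cinner y (A y)) \<le> (norm A + 1) * (norm y)\<^sup>2" for y
    by (rule order_trans[OF form_le_norm mult_right_mono]) simp_all
  from norm_sq_le_form[OF assms(1) _ this, of x] assms(2) show ?thesis
    by (simp add: add_nonneg_pos)
qed

section \<open>The positive square root\<close>

primrec sqrt_iter :: "('a::complex_inner \<Rightarrow>\<^sub>L 'a) \<Rightarrow> nat \<Rightarrow> ('a \<Rightarrow>\<^sub>L 'a)" where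
  "sqrt_iter B 0 = 0"
| "sqrt_iter B (Suc n) = (1 / 2) *\<^sub>R (B + (sqrt_iter B n o\<^sub>L sqrt_iter B n))"

text \<open>The iteration of \<open>sqrt_iter\<close> for the scalar \<open>B = 1\<close>, the largest case.\<close>

primrec majorant :: "nat \<Rightarrow> real" where
  "majorant 0 = 0"
| "majorant (Suc n) = (1 + (majorant n)\<^sup>2) / 2"

lemma majorant_bounds: "0 \<le> majorant n \<and> majorant n \<le> 1"
  by (induction n) (auto simp: power_le_one)

lemma majorant_step: "majorant n \<le> majorant (Suc n)"
proof -
  have "0 \<le> (1 - majorant n)\<^sup>2" by simp
  then show ?thesis by (simp add: power2_eq_square algebra_simps)
qed

lemma majorant_convergent: "convergent majorant"
proof (rule Bseq_mono_convergent)
  show "Bseq majorant" by (rule BseqI'[of _ 1]) (use majorant_bounds in auto)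
  show "\<forall>m n. m \<le> n \<longrightarrow> majorant m \<le> majorant n"
    using lift_Suc_mono_le[of majorant] majorant_step by blast
qed

lemma sqrt_iter_commute:
  assumes "C o\<^sub>L B = B o\<^sub>L C"
  shows "C o\<^sub>L sqrt_iter B n = sqrt_iter B n o\<^sub>L C"
proof (induction n)
  case (Suc n)
  have B: "C (B x) = B (C x)" for x
    by (metis assms blinfun_apply_blinfun_compose)
  have Y: "C (sqrt_iter B n x) = sqrt_iter B n (C x)" for x
    by (metis Suc blinfun_apply_blinfun_compose)
  show ?case
    by (rule blinfun_eqI) (simp add: blinfun.bilinear_simps B Y)
qed simp

lemma hermitian_sqrt_iter: "hermitian B \<Longrightarrow> hermitian (sqrt_iter B n)"
  by (induction n) (simp_all add: hermitian_zero hermitian_add hermitian_scaleR hermitian_square)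

lemma norm_sqrt_iter:
  assumes "norm B \<le> 1"
  shows "norm (sqrt_iter B n) \<le> majorant n"
proof (induction n)
  case (Suc n)
  let ?Y = "sqrt_iter B n"
  have "norm (B + (?Y o\<^sub>L ?Y)) \<le> norm B + norm ?Y * norm ?Y"
    by (rule norm_triangle_le[OF add_left_mono[OF norm_blinfun_compose]])
  also have "\<dots> \<le> 1 + majorant n * majorant n"
    by (intro add_mono mult_mono assms Suc) (use majorant_bounds in auto)
  finally show ?case by (simp add: power2_eq_square)
qed simp

text \<open>Consecutive iterates commute, so the difference of their squares factors as
  \<open>(Z + Y) (Z - Y)\<close>. The same factorization holds for the scalars, and the factors are compared one
  by one.\<close>

lemma norm_sqrt_iter_step:
  assumes "norm B \<le> 1"
  shows "norm (sqrt_iter B (Suc n) - sqrt_iter B n) \<le> majorant (Suc n) - majorant n"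
proof (induction n)
  case 0
  show ?case using assms by simp
next
  case (Suc n)
  let ?Y = "sqrt_iter B n" and ?Z = "sqrt_iter B (Suc n)"
  let ?y = "majorant n" and ?z = "majorant (Suc n)"
  have "?Y o\<^sub>L B = B o\<^sub>L ?Y" by (rule sqrt_iter_commute[symmetric]) simp
  then have "?Y o\<^sub>L ?Z = ?Z o\<^sub>L ?Y" by (rule sqrt_iter_commute)
  then have comm: "?Y (?Z x) = ?Z (?Y x)" for x
    by (metis blinfun_apply_blinfun_compose)
  have "sqrt_iter B (Suc (Suc n)) - ?Z = (1 / 2) *\<^sub>R ((?Z + ?Y) o\<^sub>L (?Z - ?Y))"
  proof -
    have "(?Z o\<^sub>L ?Z) - (?Y o\<^sub>L ?Y) = (?Z + ?Y) o\<^sub>L (?Z - ?Y)"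
      by (rule blinfun_eqI) (simp add: blinfun.add_left blinfun.diff_left blinfun.diff_right comm
          del: sqrt_iter.simps)
    then show ?thesis
      unfolding sqrt_iter.simps(2)[of B "Suc n"]
      by (subst sqrt_iter.simps(2)[of B n])
        (simp add: algebra_simps del: sqrt_iter.simps flip: scaleR_diff_right)
  qed
  then have "norm (sqrt_iter B (Suc (Suc n)) - ?Z) \<le> (1 / 2) * (norm (?Z + ?Y) * norm (?Z - ?Y))"
    by (simp add: norm_blinfun_compose del: sqrt_iter.simps)
  also have "\<dots> \<le> (1 / 2) * ((?z + ?y) * (?z - ?y))"
    by (intro mult_left_mono mult_mono norm_triangle_le add_mono norm_sqrt_iter[OF assms] Suc)
      (use majorant_bounds in \<open>auto simp del: majorant.simps\<close>)
  also have "\<dots> = majorant (Suc (Suc n)) - ?z"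
    by (simp add: power2_eq_square field_simps)
  finally show ?case .
qed

text \<open>The increments are dominated by those of \<open>majorant\<close>, whose sum telescopes.\<close>

lemma sqrt_iter_convergent:
  fixes B :: "'a::complex_hilbert_space \<Rightarrow>\<^sub>L 'a"
  assumes "norm B \<le> 1"
  shows "convergent (sqrt_iter B)"
proof -
  obtain l where "majorant \<longlonglongrightarrow> l"
    using majorant_convergent by (auto simp: convergent_def)
  then have "summable (\<lambda>n. majorant (Suc n) - majorant n)"
    by (rule telescope_summable)
  then have "summable (\<lambda>n. sqrt_iter B (Suc n) - sqrt_iter B n)"
    by (rule summable_comparison_test'[of _ 0]) (rule norm_sqrt_iter_step[OF assms])
  then have "convergent (\<lambda>n. \<Sum>k<n. sqrt_iter B (Suc k) - sqrt_iter B k)"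
    by (simp add: summable_iff_convergent)
  then show ?thesis
    unfolding sum_lessThan_telescope by simp
qed

text \<open>The square root is \<open>I - Y\<close> for the limit \<open>Y\<close> of the iteration with \<open>B = I - A\<close>; it is positive
  because \<open>Y\<close> has norm at most \<open>1\<close>. The commutation clause, inherited from the iterates, serves to
  compare this root with any other one.\<close>

lemma contraction_sqrt_exists:
  fixes A :: "'a::complex_hilbert_space \<Rightarrow>\<^sub>L 'a"
  assumes A: "A \<in> positive_ops" and "norm A \<le> 1"
  shows "\<exists>S\<in>positive_ops. S o\<^sub>L S = A \<and> (\<forall>C. C o\<^sub>L A = A o\<^sub>L C \<longrightarrow> C o\<^sub>L S = S o\<^sub>L C)"
proof -
  define B where "B = id_blinfun - A"
  have hB: "hermitian B"
    unfolding B_def by (intro hermitian_diff hermitian_id positive_imp_hermitian A)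
  have form: "Re (cinner x (A x)) \<le> 1 * (norm x)\<^sup>2" for x
    by (rule order_trans[OF form_le_norm mult_right_mono[OF assms(2)]]) simp
  have normB: "norm B \<le> 1"
  proof (rule norm_blinfun_bound)
    fix x
    have "B \<in> positive_ops"
      using hB form by (simp add: positive_ops_iff B_def blinfun.diff_left cinner.diff_right Re_cinner_self)
    moreover have Ble: "Re (cinner y (B y)) \<le> 1 * (norm y)\<^sup>2" for y
      using A by (simp add: positive_ops_iff B_def blinfun.diff_left cinner.diff_right Re_cinner_self)
    ultimately have "(norm (B x))\<^sup>2 \<le> 1 * Re (cinner x (B x))"
      by (intro norm_sq_le_form) auto
    with Ble[of x] have "(norm (B x))\<^sup>2 \<le> (norm x)\<^sup>2" by linarith
    then have "norm (B x) \<le> norm x" by (rule power2_le_imp_le) simp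
    then show "norm (B x) \<le> 1 * norm x" by simp
  qed simp
  obtain Y where Y: "sqrt_iter B \<longlonglongrightarrow> Y"
    using sqrt_iter_convergent[OF normB] by (auto simp: convergent_def)
  note compose_lim = bounded_bilinear.tendsto[OF bounded_bilinear_blinfun_compose]
  have hY: "hermitian Y"
    by (rule hermitian_pointwise_limit[of "sqrt_iter B"])
      (intro hermitian_sqrt_iter hB blinfun.tendsto Y tendsto_const)+
  have "norm (sqrt_iter B n) \<le> 1" for n
    using norm_sqrt_iter[OF normB, of n] majorant_bounds[of n] by linarith
  then have normY: "norm Y \<le> 1"
    by (intro Lim_norm_ubound[OF _ Y] always_eventually) simp_all
  have "(\<lambda>n. sqrt_iter B (Suc n)) \<longlonglongrightarrow> (1 / 2) *\<^sub>R (B + (Y o\<^sub>L Y))"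
    unfolding sqrt_iter.simps by (intro tendsto_intros compose_lim Y)
  moreover have "(\<lambda>n. sqrt_iter B (Suc n)) \<longlonglongrightarrow> Y" by (rule LIMSEQ_Suc[OF Y])
  ultimately have fixpoint: "(1 / 2) *\<^sub>R (B + (Y o\<^sub>L Y)) = Y" by (rule LIMSEQ_unique)
  have square: "(id_blinfun - Y) o\<^sub>L (id_blinfun - Y) = A"
  proof (rule blinfun_eqI)
    fix x
    have "(1 / 2) *\<^sub>R (B x + Y (Y x)) = Y x"
      using arg_cong[OF fixpoint, of "\<lambda>T. blinfun_apply T x"] by (simp add: blinfun.bilinear_simps)
    then have "2 *\<^sub>R Y x = 2 *\<^sub>R (1 / 2) *\<^sub>R (B x + Y (Y x))" by simp
    then show "((id_blinfun - Y) o\<^sub>L (id_blinfun - Y)) x = A x"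
      by (simp add: B_def blinfun.bilinear_simps scaleR_2 algebra_simps)
  qed
  have "Re (cinner x (Y x)) \<le> (norm x)\<^sup>2" for x
    using form_le_norm[of x Y] mult_right_mono[OF normY, of "(norm x)\<^sup>2"] by simp
  then have pos: "id_blinfun - Y \<in> positive_ops"
    by (simp add: positive_ops_iff hermitian_diff hermitian_id hY blinfun.diff_left
        cinner.diff_right Re_cinner_self)
  have "C o\<^sub>L (id_blinfun - Y) = (id_blinfun - Y) o\<^sub>L C" if C: "C o\<^sub>L A = A o\<^sub>L C" for C
  proof -
    have "C (A x) = A (C x)" for x by (metis C blinfun_apply_blinfun_compose)
    then have CB: "C o\<^sub>L B = B o\<^sub>L C"
      by (intro blinfun_eqI) (simp add: B_def blinfun.bilinear_simps)
    have "(\<lambda>n. C o\<^sub>L sqrt_iter B n) \<longlonglongrightarrow> (C o\<^sub>L Y)"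
      by (intro compose_lim Y tendsto_const)
    moreover have "(\<lambda>n. C o\<^sub>L sqrt_iter B n) \<longlonglongrightarrow> (Y o\<^sub>L C)"
      unfolding sqrt_iter_commute[OF CB] by (intro compose_lim Y tendsto_const)
    ultimately have "C o\<^sub>L Y = Y o\<^sub>L C" by (rule LIMSEQ_unique)
    then have "C (Y x) = Y (C x)" for x by (metis blinfun_apply_blinfun_compose)
    then show ?thesis by (intro blinfun_eqI) (simp add: blinfun.bilinear_simps)
  qed
  with square pos show ?thesis by blast
qed

lemma positive_scaleR: "A \<in> positive_ops \<Longrightarrow> 0 \<le> r \<Longrightarrow> r *\<^sub>R A \<in> positive_ops"
  by (simp add: positive_ops_iff hermitian_scaleR blinfun.scaleR_left cinner.scaleR_right)

lemma positive_sqrt_exists: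
  fixes A :: "'a::complex_hilbert_space \<Rightarrow>\<^sub>L 'a"
  assumes A: "A \<in> positive_ops"
  shows "\<exists>S\<in>positive_ops. S o\<^sub>L S = A \<and> (\<forall>C. C o\<^sub>L A = A o\<^sub>L C \<longrightarrow> C o\<^sub>L S = S o\<^sub>L C)"
proof -
  \<comment> \<open>The summand \<open>1\<close> keeps the scaling factor positive when \<open>A = 0\<close>.\<close>
  define c where "c = norm A + 1"
  have c: "c > 0" by (simp add: c_def add_nonneg_pos)
  have "(1 / c) *\<^sub>R A \<in> positive_ops" using A c by (simp add: positive_scaleR)
  moreover have "norm ((1 / c) *\<^sub>R A) \<le> 1" using c by (simp add: c_def)
  ultimately obtain S where S: "S \<in> positive_ops" "S o\<^sub>L S = (1 / c) *\<^sub>R A"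
    "\<And>C. C o\<^sub>L ((1 / c) *\<^sub>R A) = ((1 / c) *\<^sub>R A) o\<^sub>L C \<Longrightarrow> C o\<^sub>L S = S o\<^sub>L C"
    using contraction_sqrt_exists by metis
  note scale = bounded_bilinear.scaleR_left[OF bounded_bilinear_blinfun_compose]
    bounded_bilinear.scaleR_right[OF bounded_bilinear_blinfun_compose]
  show ?thesis
  proof (intro bexI conjI allI impI)
    show "sqrt c *\<^sub>R S \<in> positive_ops" using S(1) c by (simp add: positive_scaleR)
    show "(sqrt c *\<^sub>R S) o\<^sub>L (sqrt c *\<^sub>R S) = A"
      using c by (simp add: scale S(2))
    show "C o\<^sub>L (sqrt c *\<^sub>R S) = (sqrt c *\<^sub>R S) o\<^sub>L C" if "C o\<^sub>L A = A o\<^sub>L C" for C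
      using S(3)[of C] that by (simp add: scale)
  qed
qed

text \<open>For \<open>y = (S - T) x\<close> commutation gives \<open>(S + T) y = (S\<^sup>2 - T\<^sup>2) x = 0\<close>. The forms of \<open>S\<close> and
  \<open>T\<close> at \<open>y\<close> are nonnegative and sum to \<open>0\<close>, so \<open>S y = T y = 0\<close>; and the squared norm of \<open>y\<close> is
  \<open>cinner x ((S - T) y)\<close>.\<close>

lemma commuting_positive_sqrt_unique:
  assumes S: "S \<in> positive_ops" and T: "T \<in> positive_ops"
    and sq: "S o\<^sub>L S = T o\<^sub>L T" and comm: "S o\<^sub>L T = T o\<^sub>L S"
  shows "S = T"
proof (rule blinfun_eqI)
  fix x
  define y where "y = S x - T x"
  have "S (S x) = T (T x)" "S (T x) = T (S x)"
    using arg_cong[OF sq, of "\<lambda>A. blinfun_apply A x"] arg_cong[OF comm, of "\<lambda>A. blinfun_apply A x"]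
    by simp_all
  then have "S y + T y = 0"
    by (simp add: y_def blinfun.diff_right)
  then have "Re (cinner y (S y + T y)) = 0" by (simp add: cinner.zero_right)
  then have "Re (cinner y (S y)) + Re (cinner y (T y)) = 0" by (simp add: cinner_add_right)
  moreover have "0 \<le> Re (cinner y (S y))" "0 \<le> Re (cinner y (T y))"
    using S T by (simp_all add: positive_ops_iff)
  ultimately have "Re (cinner y (S y)) = 0" and "Re (cinner y (T y)) = 0" by linarith+
  then have "S y = 0" and "T y = 0"
    using positive_form_zero[OF S, of y] positive_form_zero[OF T, of y] by iprover+
  moreover have "cinner y y = cinner x (S y - T y)"
    by (subst (1) y_def)
      (simp add: cinner.diff_left cinner.diff_right hermitianD[OF positive_imp_hermitian] S T)
  ultimately have "cinner y y = 0" by (simp add: cinner.zero_right)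
  then have "y = 0" by (simp add: cinner_eq_zero_iff)
  then show "S x = T x" by (simp add: y_def)
qed

text \<open>Any positive root \<open>T\<close> of \<open>A\<close> commutes with \<open>A = T\<^sup>2\<close>, hence with the constructed root, so the
  description in \<open>op_sqrt_def\<close> is met by exactly one operator.\<close>

lemma op_sqrt_spec:
  fixes A :: "'a::complex_hilbert_space \<Rightarrow>\<^sub>L 'a"
  assumes "A \<in> positive_ops"
  shows "op_sqrt A \<in> positive_ops" and "op_sqrt A o\<^sub>L op_sqrt A = A"
proof -
  obtain S where S: "S \<in> positive_ops" "S o\<^sub>L S = A"
    "\<And>C. C o\<^sub>L A = A o\<^sub>L C \<Longrightarrow> C o\<^sub>L S = S o\<^sub>L C"
    using positive_sqrt_exists[OF assms] by blast
  have "op_sqrt A = S"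
    unfolding op_sqrt_def
  proof (rule the_equality)
    show "S \<in> positive_ops \<and> S o\<^sub>L S = A" using S(1,2) by (rule conjI)
    fix T assume T: "T \<in> positive_ops \<and> T o\<^sub>L T = A"
    then have "A y = T (T y)" for y by (metis blinfun_apply_blinfun_compose)
    then have "T o\<^sub>L A = A o\<^sub>L T" by (intro blinfun_eqI) simp
    then have "T o\<^sub>L S = S o\<^sub>L T" by (rule S(3))
    then show "T = S"
      by (rule commuting_positive_sqrt_unique[rotated 3]) (use T S(1,2) in simp_all)
  qed
  with S(1,2) show "op_sqrt A \<in> positive_ops" "op_sqrt A o\<^sub>L op_sqrt A = A" by simp_all
qed

section \<open>Monotone convergence of positive operators\<close>

lemma loewner_le_hermitian_iff:
  assumes "hermitian A" "hermitian B"
  shows "loewner_le A B \<longleftrightarrow> (\<forall>x. Re (cinner x (A x)) \<le> Re (cinner x (B x)))"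
  using assms by (simp add: loewner_le_def less_eq_complex_def hermitian_Im_form)

lemma loewner_le_trans: "loewner_le A B \<Longrightarrow> loewner_le B C \<Longrightarrow> loewner_le A C"
  by (simp add: loewner_le_def less_eq_complex_def) (metis order_trans)

lemma bounded_ops_eq_if_forms_eq:
  assumes "A \<in> bounded_ops" "B \<in> bounded_ops" "\<And>x. cinner x (A x) = cinner x (B x)"
  shows "A = B"
proof -
  have "cinner x (A y) - cinner x (B y) = 0" for x y
    by (rule sesquilinear_zero_if_diagonal_zero[where s = "\<lambda>x y. cinner x (A y) - cinner x (B y)"])
      (use assms in \<open>simp_all add: bounded_ops_def cinner_add_left cinner_add_right
         cinner_scaleC_left cinner_scaleC_right blinfun.add_right algebra_simps\<close>)
  then show ?thesis by (intro blinfun_eqI cinner_eqI) simp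
qed

text \<open>The strong operator topology is pulled back from the product topology on functions, where
  convergence is pointwise.\<close>

lemma limitin_strong_operator_topology:
  assumes "\<And>x. (\<lambda>n. blinfun_apply (X n) x) \<longlonglongrightarrow> blinfun_apply L x"
  shows "limitin strong_operator_topology X L sequentially"
  unfolding limitin_def
proof (intro conjI allI impI)
  show "L \<in> topspace strong_operator_topology"
    by (simp add: strong_operator_topology_topspace)
  fix U assume "openin strong_operator_topology U \<and> L \<in> U"
  then obtain V where V: "open V" "U = blinfun_apply -` V" "blinfun_apply L \<in> V"
    by (auto simp: strong_operator_topology_def openin_pullback_topology)
  have "limitin (product_topology (\<lambda>_. euclidean) UNIV) (\<lambda>n. blinfun_apply (X n))
      (blinfun_apply L) sequentially"
    by (subst limitin_componentwise) (use assms in auto)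
  then have "(\<lambda>n. blinfun_apply (X n)) \<longlonglongrightarrow> blinfun_apply L"
    by (simp add: euclidean_product_topology)
  from topological_tendstoD[OF this V(1,3)] show "\<forall>\<^sub>F n in sequentially. X n \<in> U"
    by (simp add: V(2))
qed

text \<open>All forms, and those of the differences \<open>R m - R n\<close> for \<open>m \<le> n\<close>, are bounded by the same \<open>M\<close>.
  Hence \<open>norm_sq_le_form\<close> makes \<open>R n x\<close> a Cauchy sequence, and applied to \<open>R n\<close> itself it bounds the
  pointwise limit.\<close>

lemma decreasing_positive_ops_converge:
  fixes R :: "nat \<Rightarrow> 'a::complex_hilbert_space \<Rightarrow>\<^sub>L 'a"
  assumes pos: "\<And>n. R n \<in> positive_ops"
    and dec: "\<And>m n. m \<le> n \<Longrightarrow> loewner_le (R n) (R m)"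
  shows "\<exists>S\<in>positive_ops. \<forall>x. (\<lambda>n. R n x) \<longlonglongrightarrow> S x"
proof -
  define q where "q n x = Re (cinner x (R n x))" for n x
  define M where "M = norm (R 0) + 1"
  have M: "M > 0" by (simp add: M_def add_nonneg_pos)
  note herm = positive_imp_hermitian[OF pos]
  have q0: "0 \<le> q n x" for n x using pos by (simp add: q_def positive_ops_iff)
  have qdec: "q n x \<le> q m x" if "m \<le> n" for m n x
    using dec[OF that] by (simp add: q_def loewner_le_hermitian_iff herm)
  have qM: "q n x \<le> M * (norm x)\<^sup>2" for n x
  proof -
    have "q n x \<le> q 0 x" by (rule qdec) simp
    also have "\<dots> \<le> norm (R 0) * (norm x)\<^sup>2" unfolding q_def by (rule form_le_norm)
    also have "\<dots> \<le> M * (norm x)\<^sup>2" by (rule mult_right_mono) (simp_all add: M_def)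
    finally show ?thesis .
  qed
  have diff: "(norm (R m x - R n x))\<^sup>2 \<le> M * (q m x - q n x)" if mn: "m \<le> n" for m n x
  proof -
    have form: "Re (cinner y ((R m - R n) y)) = q m y - q n y" for y
      by (simp add: q_def blinfun.diff_left cinner.diff_right)
    have "R m - R n \<in> positive_ops"
      using qdec[OF mn] by (simp add: positive_ops_iff hermitian_diff herm form)
    moreover have "Re (cinner y ((R m - R n) y)) \<le> M * (norm y)\<^sup>2" for y
      using q0[of n y] qM[of m y] by (simp add: form)
    ultimately have "(norm ((R m - R n) x))\<^sup>2 \<le> M * Re (cinner x ((R m - R n) x))"
      by (intro norm_sq_le_form M)
    then show ?thesis unfolding form by (simp add: blinfun.diff_left)
  qed
  have "Cauchy (\<lambda>n. R n x)" for x
  proof (rule metric_CauchyI)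
    fix e :: real assume e: "0 < e"
    have "decseq (\<lambda>n. q n x)" using qdec by (simp add: decseq_def)
    then obtain l where "(\<lambda>n. q n x) \<longlonglongrightarrow> l"
      using decseq_convergent[of "\<lambda>n. q n x" 0] q0 by blast
    then have "Cauchy (\<lambda>n. q n x)" by (rule LIMSEQ_imp_Cauchy)
    moreover have "0 < e\<^sup>2 / M" using e M by simp
    ultimately obtain N where N: "\<And>m n. m \<ge> N \<Longrightarrow> n \<ge> N \<Longrightarrow> dist (q m x) (q n x) < e\<^sup>2 / M"
      unfolding Cauchy_def by metis
    have close: "norm (R m x - R n x) < e" if "N \<le> m" "m \<le> n" for m n
    proof -
      have "q m x - q n x < e\<^sup>2 / M"
        using N[of m n] that by (simp add: dist_real_def)
      then have "M * (q m x - q n x) < e\<^sup>2" using M by (simp add: field_simps)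
      with diff[OF that(2)] have "(norm (R m x - R n x))\<^sup>2 < e\<^sup>2"
        by (rule order_le_less_trans)
      then show ?thesis using e by (simp add: power_less_imp_less_base)
    qed
    show "\<exists>N. \<forall>m\<ge>N. \<forall>n\<ge>N. dist (R m x) (R n x) < e"
    proof (intro exI allI impI)
      fix m n assume "N \<le> m" "N \<le> n"
      then show "dist (R m x) (R n x) < e"
        using close[of m n] close[of n m] by (cases "m \<le> n") (auto simp: dist_norm norm_minus_commute)
    qed
  qed
  then have "\<exists>y. (\<lambda>n. R n x) \<longlonglongrightarrow> y" for x
    by (simp add: Cauchy_convergent_iff convergent_def)
  then obtain f where f: "\<And>x. (\<lambda>n. R n x) \<longlonglongrightarrow> f x" by metis
  have normR: "norm (R n x) \<le> M * norm x" for n x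
  proof -
    have "(norm (R n x))\<^sup>2 \<le> M * q n x"
      unfolding q_def using qM by (intro norm_sq_le_form pos M) (simp add: q_def)
    also have "\<dots> \<le> M * (M * (norm x)\<^sup>2)" using M by (intro mult_left_mono qM) simp
    also have "\<dots> = (M * norm x)\<^sup>2" by (simp add: power2_eq_square)
    finally show ?thesis by (rule power2_le_imp_le) (use M in simp)
  qed
  have "bounded_linear f"
  proof (rule bounded_linear_intro)
    fix x y :: 'a and r :: real
    show "f (x + y) = f x + f y"
      using f[of "x + y"] tendsto_add[OF f f] by (simp add: blinfun.add_right LIMSEQ_unique)
    show "f (r *\<^sub>R x) = r *\<^sub>R f x"
      using f[of "r *\<^sub>R x"] tendsto_scaleR[OF tendsto_const f]
      by (simp add: blinfun.scaleR_right LIMSEQ_unique)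
    show "norm (f x) \<le> norm x * M"
      using LIMSEQ_le_const2[OF tendsto_norm[OF f]] normR by (metis mult.commute)
  qed
  then obtain S :: "'a \<Rightarrow>\<^sub>L 'a" where S: "blinfun_apply S = f"
    using bounded_linear_Blinfun_apply by blast
  have "0 \<le> Re (cinner x (f x))" for x
    by (rule LIMSEQ_le_const[OF tendsto_Re[OF cinner.tendsto[OF tendsto_const f]]])
      (use q0 in \<open>auto simp: q_def\<close>)
  moreover have "hermitian S"
    by (rule hermitian_pointwise_limit[of R]) (simp_all add: herm f S)
  ultimately have "S \<in> positive_ops" by (simp add: positive_ops_iff S)
  with f show ?thesis by (intro bexI[of _ S]) (simp_all add: S)
qed

section \<open>Compressing by a rank-one projection\<close>

text \<open>With \<open>T = op_sqrt A\<close>, the form of \<open>A'\<close> at \<open>x\<close> is the squared distance of \<open>T x\<close> from the line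
  spanned by \<open>u\<close>, while the form of \<open>A\<close> is its squared distance from \<open>0\<close>.\<close>

lemma residual_step:
  fixes A :: "'a::complex_hilbert_space \<Rightarrow>\<^sub>L 'a"
  assumes A: "A \<in> positive_ops" and u: "norm u = 1"
  defines "A' \<equiv> op_sqrt A o\<^sub>L (id_blinfun - rank_one u u) o\<^sub>L op_sqrt A"
  shows "A' \<in> positive_ops" and "loewner_le A' A"
proof -
  define T where "T = op_sqrt A"
  have hT: "hermitian T" unfolding T_def by (rule positive_imp_hermitian[OF op_sqrt_spec(1)[OF A]])
  have TT: "T (T x) = A x" for x
    unfolding T_def by (metis op_sqrt_spec(2)[OF A] blinfun_apply_blinfun_compose)
  have hA': "hermitian A'"
    unfolding A'_def by (fold T_def)
      (intro hermitian_sandwich hT hermitian_diff hermitian_id hermitian_rank_one)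
  have P: "cinner y (cinner u y *\<^sub>C u) = complex_of_real ((cmod (cinner u y))\<^sup>2)" for y
    using cinner_commute[of y u] by (simp add: cinner_scaleC_right complex_norm_square del: of_real_power)
  have formA: "Re (cinner x (A x)) = (norm (T x))\<^sup>2" for x
    by (simp flip: TT hermitianD[OF hT] Re_cinner_self)
  have formA': "Re (cinner x (A' x)) = (norm (T x))\<^sup>2 - (cmod (cinner u (T x)))\<^sup>2" for x
  proof -
    have "cinner x (A' x) = cinner (T x) ((id_blinfun - rank_one u u) (T x))"
      by (simp add: A'_def T_def[symmetric] hermitianD[OF hT])
    then show ?thesis
      by (simp add: blinfun.diff_left rank_one.rep_eq cinner.diff_right P Re_cinner_self
          del: of_real_power)
  qed
  have "(cmod (cinner u (T x)))\<^sup>2 \<le> (norm (T x))\<^sup>2" for x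
    using cinner_Cauchy_Schwarz[of u "T x"] u by (intro power_mono) simp_all
  then show "A' \<in> positive_ops" by (simp add: positive_ops_iff hA' formA')
  show "loewner_le A' A"
    by (simp add: loewner_le_hermitian_iff hA' positive_imp_hermitian[OF A] formA formA')
qed

theorem proposition3p1:
  fixes R :: "nat \<Rightarrow> ('a::complex_hilbert_space \<Rightarrow>\<^sub>L 'a)"
    and u :: "nat \<Rightarrow> 'a"
  assumes "R 0 \<in> positive_ops"
    and "\<And>n. norm (u n) = 1"
    and "\<And>n. R (Suc n) =
           op_sqrt (R n) o\<^sub>L (id_blinfun - rank_one (u n) (u n)) o\<^sub>L op_sqrt (R n)"
  shows "(\<forall>n. R n \<in> positive_ops)
    \<and> (\<forall>m n. m \<le> n \<longrightarrow> loewner_le (R n) (R m))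
    \<and> (\<forall>n. loewner_le 0 (R n))
    \<and> (\<exists>!S. S \<in> positive_ops \<and>
          (\<forall>x. (\<lambda>n. cinner x (blinfun_apply (R n) x)) \<longlonglongrightarrow> cinner x (blinfun_apply S x)))
    \<and> (\<forall>S. S \<in> positive_ops \<and>
          (\<forall>x. (\<lambda>n. cinner x (blinfun_apply (R n) x)) \<longlonglongrightarrow> cinner x (blinfun_apply S x))
        \<longrightarrow> limitin strong_operator_topology R S sequentially)"
proof -
  have pos: "R n \<in> positive_ops" for n
  proof (induction n)
    case 0
    show ?case by (rule assms(1))
  next
    case (Suc n)
    show ?case unfolding assms(3)[of n] by (rule residual_step(1)[OF Suc assms(2)])
  qed
  have decreasing: "loewner_le (R (Suc n)) (R n)" for n
    unfolding assms(3)[of n] by (rule residual_step(2)[OF pos assms(2)])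
  have dec: "loewner_le (R n) (R m)" if "m \<le> n" for m n
    using that
  proof (induction n rule: dec_induct)
    case base
    show ?case by (simp add: loewner_le_def)
  next
    case (step k)
    show ?case by (rule loewner_le_trans[OF decreasing step.IH])
  qed
  have lower: "loewner_le 0 (R n)" for n
    using pos[of n] by (simp add: loewner_le_def positive_ops_def cinner.zero_right)
  have "\<exists>S\<in>positive_ops. \<forall>x. (\<lambda>n. R n x) \<longlonglongrightarrow> S x"
    by (rule decreasing_positive_ops_converge) (fact pos, fact dec)
  then obtain S where S: "S \<in> positive_ops" "\<And>x. (\<lambda>n. R n x) \<longlonglongrightarrow> S x"
    by blast
  have form: "(\<lambda>n. cinner x (R n x)) \<longlonglongrightarrow> cinner x (S x)" for x
    by (intro cinner.tendsto tendsto_const S(2))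
  have unique: "S' = S"
    if "S' \<in> positive_ops" "\<forall>x. (\<lambda>n. cinner x (R n x)) \<longlonglongrightarrow> cinner x (S' x)" for S'
  proof (rule bounded_ops_eq_if_forms_eq)
    show "S' \<in> bounded_ops" "S \<in> bounded_ops" using that(1) S(1) by (auto simp: positive_ops_def)
    show "cinner x (S' x) = cinner x (S x)" for x
      by (rule LIMSEQ_unique[OF that(2)[rule_format] form])
  qed
  have strong: "limitin strong_operator_topology R S sequentially"
    by (rule limitin_strong_operator_topology[OF S(2)])
  show ?thesis
  proof (intro conjI allI impI)
    show "\<exists>!S. S \<in> positive_ops \<and> (\<forall>x. (\<lambda>n. cinner x (R n x)) \<longlonglongrightarrow> cinner x (S x))"
      by (rule ex1I[of _ S]) (simp add: S(1) form, rule unique, simp_all)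
  next
    fix S'
    assume "S' \<in> positive_ops \<and> (\<forall>x. (\<lambda>n. cinner x (R n x)) \<longlonglongrightarrow> cinner x (S' x))"
    then have "S' = S" by (intro unique) simp_all
    with strong show "limitin strong_operator_topology R S' sequentially" by simp
  qed (fact pos, erule dec, fact lower)
qed

end
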